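(* Let $a,b\in\mathbb{C}^*$ and let $K(h)\in\mathrm{GL}_2(\mathbb{C}[h])$. Then $K(h)$ is $\sigma^{-1}$-similar to $\mathrm{diag}(a,b)$ if and only if $K(h)$ is in any of the following standard forms, where $\varepsilon,\delta\in\{0,1\}$, $\beta,\eta\in\mathbb{C}^*$, and $\mathbf u=(u_1,\dots,u_k)\in(\mathbb{C}[h]\setminus\mathbb{C})^k$ for $k\in\mathbb{Z}_{\ge1}$: (1) $\mathrm{diag}(a,b)_{[\varepsilon]}$; (2) $\mathrm{diag}(-a,-b)_{[\delta]}\,E(0)^{1-\varepsilon}E(\beta)E(0)^{\varepsilon}$; (3) $-\mathrm{diag}(a\beta^{-1},b\beta)\,E\!\left(-\beta-\beta\tfrac{b}{a}\right)$; (4) $\mathrm{diag}(-a\beta\eta^{-1},-b\eta\beta^{-1})\,E(\eta)\,E\!\left(-\tfrac{(\beta-\eta)b}{a\beta^2}+\tfrac{\beta-\eta}{\beta\eta}\right)$; (5) $-\mathrm{diag}(b(\beta\eta)^{-1},a\beta\eta)\,E(-\eta)\,E\!\left(-\beta^2\tfrac{a}{b}u_1-\beta-\eta^{-1}\right)E\!\left(u_1(h+1)-\beta^{-1}\right)E\!\left(-\eta\beta^2\tfrac{a}{b}\right)$; (6) $\mathbf D_{(a,b)}(\varepsilon,\delta;\mathbf u)$; (7) $\mathbf G_{(a,b)}(\varepsilon;\beta;\mathbf u)$; (8) $\mathbf K_{(a,b)}(\varepsilon;\eta;\mathbf u)$; (9) $\mathbf Z_{(a,b)}(\beta,\eta;\mathbf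 u)$. Here every $k\ge1$ is allowed in (6)–(9).
   Context: $\mathbb{C}[h]$ is the polynomial ring in $h$, $\mathbb{C}^*=\mathbb{C}\setminus\{0\}$. For $u\in\mathbb{C}[h]$, $E(u)=\begin{pmatrix}u(h)&1\\-1&0\end{pmatrix}$. Matrices $A,B\in\mathrm{GL}_2(\mathbb{C}[h])$ are $\sigma^{-1}$-similar if $B(h)=P(h)^{-1}A(h)P(h+1)$ for some $P(h)\in\mathrm{GL}_2(\mathbb{C}[h])$. A product $\mathrm{diag}(\omega_1,\omega_2)E(v_1)\cdots E(v_\ell)$ with $\omega_1,\omega_2\in\mathbb{C}^*$, $\ell\ge0$, $v_i\in\mathbb{C}[h]$, is in standard form if $v_i\notin\mathbb{C}$ for $1<i<\ell$ and, when $\ell=2$, $(v_1,v_2)\ne(0,0)$. For $x,y\in\mathbb{C}^*$ and $n\in\mathbb{Z}$, $\mathrm{diag}(x,y)_{[n]}$ means $\mathrm{diag}(x,y)$ if $n$ is even and $\mathrm{diag}(y,x)$ if $n$ is odd. The symbol $\overleftarrow{\prod}_{i=n}^{m}M_i$ denotes the product in decreasing order of index, $M_mM_{m-1}\cdots M_n$; $\prod_{i=n}^m M_i=M_nM_{n+1}\cdots M_m$; empty products are the identity. For $\varepsilon,\delta\in\{0,1\}$, $\beta,\eta\in\mathbb{C}^*$, $k\ge1$, $\mathbf u=(u_1,\dots,u_k)$: $$\mathbf D_{(a,b)}(\varepsilon,\delta;\mathbf u)=(-1)^k\,\mathrm{diag}(a,b)_{[k+\varepsilon+\delta]}\,E(0)^{1-\varepsilon}\Bigl(\overleftarrow{\prod}_{i=2}^{k}E\bigl(-(\tfrac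 ab)^{(-1)^{i+\delta}}u_i\bigr)\Bigr)E(u_1)\Bigl(\prod_{j=2}^kE(u_j(h+1))\Bigr)E(0)^{\varepsilon},$$ $$\mathbf G_{(a,b)}(\varepsilon;\beta;\mathbf u)=(-1)^{k+1}\,\mathrm{diag}(a,b)_{[k+1-\varepsilon]}\,\mathrm{diag}\bigl(\beta^{(-1)^{k+1-\varepsilon}},\beta^{(-1)^{k+\varepsilon}}\bigr)E(0)^{1-\varepsilon}\Bigl(\overleftarrow{\prod}_{i=2}^{k}E\bigl(-(\beta^2\tfrac ab)^{(-1)^{i+1}}u_i\bigr)\Bigr)$$ $$\qquad\cdot E\bigl(-\beta^2\tfrac ab u_1-\beta\bigr)E\bigl(u_1(h+1)-\beta^{-1}\bigr)\Bigl(\prod_{j=2}^kE(u_j(h+1))\Bigr)E(0)^{\varepsilon};$$ for $k\ge2$, $$\mathbf K_{(a,b)}(\varepsilon;\eta;\mathbf u)=(-1)^{k+1}\,\mathrm{diag}(a,b)_{[k+1-\varepsilon]}\,\mathrm{diag}(\eta^{-1},\eta)\,E(-\eta)\,E\bigl(-(\tfrac ab)^{(-1)^{k+\varepsilon}}u_k-\eta^{-1}\bigr)$$ $$\qquad\cdot\Bigl(\overleftarrow{\prod}_{i=2}^{k-1}E\bigl(-(\tfrac ab)^{(-1)^{i+\varepsilon}}u_i\bigr)\Bigr)E(u_1)\Bigl(\prod_{j=2}^kE(u_j(h+1))\Bigr)E\bigl(-\eta(\tfrac ba)^{(-1)^{k+1-\varepsilon}}\bigr),$$ and for $k=1$, by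 convention, $$\mathbf K_{(a,b)}(\varepsilon;\eta;(u_1))=\mathrm{diag}(a,b)_{[\varepsilon]}\,\mathrm{diag}(\eta^{-1},\eta)\,E(-\eta)\,E(u_1)\,E\bigl(-\eta(\tfrac ba)^{(-1)^{\varepsilon}}\bigr);$$ for $k\ge2$, $$\mathbf Z_{(a,b)}(\beta,\eta;\mathbf u)=(-1)^{k}\,\mathrm{diag}(a,b)_{[k]}\,\mathrm{diag}\bigl(\eta^{-1}\beta^{(-1)^k},\eta\beta^{(-1)^{k+1}}\bigr)E(-\eta)\,E\bigl(-(\beta^2\tfrac ab)^{(-1)^{k+1}}u_k-\eta^{-1}\bigr)$$ $$\qquad\cdot\Bigl(\overleftarrow{\prod}_{i=2}^{k-1}E\bigl(-(\beta^2\tfrac ab)^{(-1)^{i+1}}u_i\bigr)\Bigr)E\bigl(-\beta^2\tfrac ab u_1-\beta\bigr)E\bigl(u_1(h+1)-\beta^{-1}\bigr)\Bigl(\prod_{j=2}^kE(u_j(h+1))\Bigr)E\bigl(-\eta(\beta^2\tfrac ab)^{(-1)^{k+1}}\bigr),$$ and for $k=1$, by convention, $$\mathbf Z_{(a,b)}(\beta,\eta;(u_1))=-\mathrm{diag}(b\eta^{-1}\beta^{-1},a\eta\beta)\,E(-\eta)\,E\bigl(-\beta^2\tfrac ab u_1-\beta\bigr)E\bigl(u_1(h+1)-\beta^{-1}\bigr)E\bigl(-\eta\beta^2\tfrac ab\bigr).$$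
   Formalization: In (9) with k=1, the printed convention for Z is false (e.g. a=b=β=η=1, u_1=h); the missing summand -η^{-1} is added, so its second E-factor is E(-β²(a/b)u_1-β-η^{-1}), and (9) at k=1 coincides with (5). *)

theory Defs
  imports "HOL-Analysis.Analysis" "HOL-Computational_Algebra.Polynomial"
begin

text \<open>\<open>complex poly ^ 2 ^ 2\<close> is the ring of 2 x 2 matrices over \<open>\<complex>[h]\<close>; \<open>GL\<^sub>2(\<complex>[h])\<close> consists of
  those \<open>A\<close> with \<^term>\<open>invertible A\<close>, and \<open>p(h + 1)\<close> is \<^term>\<open>pcompose p [:1, 1:]\<close>.\<close>

type_synonym pmat = "complex poly ^ 2 ^ 2"

definition shift :: "complex poly \<Rightarrow> complex poly" where
  "shift p = pcompose p [:1, 1:]"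

definition shift_mat :: "pmat \<Rightarrow> pmat" where
  "shift_mat P = (\<chi> i j. shift (P $ i $ j))"

definition sigma_inv_similar :: "pmat \<Rightarrow> pmat \<Rightarrow> bool" where
  "sigma_inv_similar A B \<longleftrightarrow>
     (\<exists>P. invertible P \<and> B = matrix_inv P ** A ** shift_mat P)"

definition E :: "complex poly \<Rightarrow> pmat" where
  "E u = vector [vector [u, 1], vector [- 1, 0]]"

definition diag2 :: "complex \<Rightarrow> complex \<Rightarrow> pmat" where
  "diag2 x y = vector [vector [[:x:], 0], vector [0, [:y:]]]"

definition diag2_br :: "complex \<Rightarrow> complex \<Rightarrow> int \<Rightarrow> pmat" where
  "diag2_br x y n = (if even n then diag2 x y else diag2 y x)"

text \<open>The operations \<open>*\<close> and \<open>^\<close> that the library provides on \<^typ>\<open>pmat\<close> are componentwise,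
  so powers and ordered products with respect to \<open>**\<close> are introduced here.\<close>

definition mat_pow :: "pmat \<Rightarrow> nat \<Rightarrow> pmat" where
  "mat_pow M n = (((**) M) ^^ n) (mat 1)"

definition mat_prod_list :: "pmat list \<Rightarrow> pmat" where
  "mat_prod_list Ms = foldr (**) Ms (mat 1)"

definition prod_up :: "nat \<Rightarrow> nat \<Rightarrow> (nat \<Rightarrow> pmat) \<Rightarrow> pmat" where
  "prod_up n m M = mat_prod_list (map M [n..<Suc m])"

definition prod_down :: "nat \<Rightarrow> nat \<Rightarrow> (nat \<Rightarrow> pmat) \<Rightarrow> pmat" where
  "prod_down n m M = mat_prod_list (map M (rev [n..<Suc m]))"

text \<open>In the following families the tuple \<open>(u\<^sub>1, \<dots>, u\<^sub>k)\<close> is given by \<open>k\<close> and a function \<open>u\<close> of which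
  only \<open>u 1, \<dots>, u k\<close> are used. The sign \<open>(-1)\<^sup>n\<close> is the scalar matrix \<^term>\<open>mat ((- 1) ^ n)\<close>.
  The parameters \<open>e\<close> and \<open>d\<close> take values in \<open>{0, 1}\<close> and \<open>k \<ge> 1\<close>, so no
  subtraction of natural numbers below is truncated.\<close>

definition D_form ::
  "complex \<Rightarrow> complex \<Rightarrow> nat \<Rightarrow> nat \<Rightarrow> nat \<Rightarrow> (nat \<Rightarrow> complex poly) \<Rightarrow> pmat" where
  "D_form a b e d k u =
     mat ((- 1) ^ k) ** diag2_br a b (int (k + e + d)) ** mat_pow (E 0) (1 - e)
     ** prod_down 2 k (\<lambda>i. E (- smult ((a / b) powi ((- 1) ^ (i + d))) (u i)))
     ** E (u 1)
     ** prod_up 2 k (\<lambda>j. E (shift (u j)))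
     ** mat_pow (E 0) e"

definition G_form ::
  "complex \<Rightarrow> complex \<Rightarrow> nat \<Rightarrow> complex \<Rightarrow> nat \<Rightarrow> (nat \<Rightarrow> complex poly) \<Rightarrow> pmat" where
  "G_form a b e \<beta> k u =
     mat ((- 1) ^ (k + 1)) ** diag2_br a b (int (k + 1 - e))
     ** diag2 (\<beta> powi ((- 1) ^ (k + 1 - e))) (\<beta> powi ((- 1) ^ (k + e)))
     ** mat_pow (E 0) (1 - e)
     ** prod_down 2 k (\<lambda>i. E (- smult ((\<beta>\<^sup>2 * (a / b)) powi ((- 1) ^ (i + 1))) (u i)))
     ** E (- smult (\<beta>\<^sup>2 * (a / b)) (u 1) - [:\<beta>:])
     ** E (shift (u 1) - [:inverse \<beta>:])
     ** prod_up 2 k (\<lambda>j. E (shift (u j)))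
     ** mat_pow (E 0) e"

definition K_form ::
  "complex \<Rightarrow> complex \<Rightarrow> nat \<Rightarrow> complex \<Rightarrow> nat \<Rightarrow> (nat \<Rightarrow> complex poly) \<Rightarrow> pmat" where
  "K_form a b e \<eta> k u =
     (if k = 1 then
        diag2_br a b (int e) ** diag2 (inverse \<eta>) \<eta> ** E [:- \<eta>:] ** E (u 1)
        ** E [:- (\<eta> * (b / a) powi ((- 1) ^ e)):]
      else
        mat ((- 1) ^ (k + 1)) ** diag2_br a b (int (k + 1 - e)) ** diag2 (inverse \<eta>) \<eta>
        ** E [:- \<eta>:]
        ** E (- smult ((a / b) powi ((- 1) ^ (k + e))) (u k) - [:inverse \<eta>:])
        ** prod_down 2 (k - 1) (\<lambda>i. E (- smult ((a / b) powi ((- 1) ^ (i + e))) (u i)))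
        ** E (u 1)
        ** prod_up 2 k (\<lambda>j. E (shift (u j)))
        ** E [:- (\<eta> * (b / a) powi ((- 1) ^ (k + 1 - e))):])"

text \<open>For \<open>k = 1\<close> the summand \<open>- \<eta>\<^sup>-\<^sup>1\<close> that the case \<open>k \<ge> 2\<close> attaches to \<open>u\<^sub>k\<close> is attached to the
  factor with \<open>u\<^sub>1\<close>. This corrects the source, whose convention for \<open>k = 1\<close> omits it: the matrix \<open>Z\<close>
  without this summand is in general not similar to \<open>diag(a, b)\<close>. For \<open>a = b = \<beta> = \<eta> = 1\<close> and
  \<open>u\<^sub>1 = h\<close>, a row \<open>(x, y)\<close> of an invertible \<open>Q\<close> with \<open>Q(h) Z(h) = Q(h + 1)\<close> has
  \<open>y(h) = s(h + 1) - h s(h)\<close> and \<open>s(h + 2) - s(h + 1) + s(h) = 0\<close> for \<open>s = x + y\<close>, and comparing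
  leading coefficients gives \<open>s = 0\<close> and \<open>(x, y) = (0, 0)\<close>.\<close>

definition Z_form ::
  "complex \<Rightarrow> complex \<Rightarrow> complex \<Rightarrow> complex \<Rightarrow> nat \<Rightarrow> (nat \<Rightarrow> complex poly) \<Rightarrow> pmat" where
  "Z_form a b \<beta> \<eta> k u =
     (if k = 1 then
        - (diag2 (b * inverse \<eta> * inverse \<beta>) (a * \<eta> * \<beta>) ** E [:- \<eta>:]
           ** E (- smult (\<beta>\<^sup>2 * (a / b)) (u 1) - [:\<beta>:] - [:inverse \<eta>:])
           ** E (shift (u 1) - [:inverse \<beta>:])
           ** E [:- (\<eta> * \<beta>\<^sup>2 * (a / b)):])
      else
        mat ((- 1) ^ k) ** diag2_br a b (int k)
        ** diag2 (inverse \<eta> * \<beta> powi ((- 1) ^ k)) (\<eta> * \<beta> powi ((- 1) ^ (k + 1)))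
        ** E [:- \<eta>:]
        ** E (- smult ((\<beta>\<^sup>2 * (a / b)) powi ((- 1) ^ (k + 1))) (u k) - [:inverse \<eta>:])
        ** prod_down 2 (k - 1) (\<lambda>i. E (- smult ((\<beta>\<^sup>2 * (a / b)) powi ((- 1) ^ (i + 1))) (u i)))
        ** E (- smult (\<beta>\<^sup>2 * (a / b)) (u 1) - [:\<beta>:])
        ** E (shift (u 1) - [:inverse \<beta>:])
        ** prod_up 2 k (\<lambda>j. E (shift (u j)))
        ** E [:- (\<eta> * (\<beta>\<^sup>2 * (a / b)) powi ((- 1) ^ (k + 1))):])"

definition nonconst_tuple :: "nat \<Rightarrow> (nat \<Rightarrow> complex poly) \<Rightarrow> bool" where
  "nonconst_tuple k u \<longleftrightarrow> (\<forall>i\<in>{1..k}. degree (u i) > 0)"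

end

theory Submission
  imports Defs
begin

text \<open>A matrix similar to \<open>\<Delta> = diag(a, b)\<close> is \<open>K = P(h) \<Delta> P(h + 1)\<^sup>-\<^sup>1\<close> with \<open>P\<close> in
  \<open>GL\<^sub>2(\<complex>[h])\<close>, so the theorem describes the orbit of \<open>\<Delta>\<close> under twisted conjugation. The
  Euclidean algorithm on the first column of \<open>P\<close> yields a factorization
  \<open>P = X E(v\<^sub>1) \<cdots> E(v\<^sub>m) T\<close> in which \<open>T\<close> is upper triangular, every \<open>v\<^sub>i\<close> is nonconstant, and
  \<open>X\<close> is the identity, \<open>E(0)\<close>, or a lower unitriangular matrix with a nonzero constant corner
  (\<open>lower t\<close>). The factor \<open>X\<close> comes from the first division, the only one whose quotient may be
  constant. Everything then follows from applying the factors to \<open>\<Delta>\<close> from the inside out.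

  The factor \<open>T\<close> turns \<open>\<Delta>\<close> into an upper triangular matrix with diagonal \<open>(a, b)\<close>. A nonconstant
  corner makes this a word \<open>D\<close> of length \<open>k = 1\<close>. If the corner is a nonzero constant, the next
  \<open>E(v)\<close> makes it a word \<open>G\<close> of length \<open>1\<close> (\<open>G_form_base\<close>); if the corner is zero, the result is
  again upper triangular, with \<open>a\<close> and \<open>b\<close> exchanged. Each further \<open>E(v)\<close> wraps a word in a mirrored
  pair of factors, \<open>E(- c u)\<close> on the left and \<open>E(u(h + 1))\<close> on the right, where \<open>u = - v\<close> and \<open>c\<close> is
  the quotient of the two entries of the diagonal prefix (\<open>word_extend\<close>). Nonconstant \<open>v\<close> thus only
  increase \<open>k\<close> (\<open>core_step\<close>). The outermost factor distinguishes the families: the identity gives the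
  words \<open>D\<close> and \<open>G\<close> with \<open>\<epsilon> = 1\<close>, the matrix \<open>E(0)\<close> those with \<open>\<epsilon> = 0\<close>, and \<open>lower t\<close> turns \<open>D\<close> into
  \<open>K\<close> and \<open>G\<close> into \<open>Z\<close> (\<open>K_form_lower\<close>, \<open>Z_form_lower\<close>).

  The results that remain constant are the constant matrices with trace \<open>a + b\<close> and determinant
  \<open>a b\<close>, and the constant entries of the list parametrize exactly these (\<open>const_listed\<close>,
  \<open>const_similar\<close>).

  Conversely, the same identities reduce every word of the list to an upper triangular matrix whose
  diagonal consists of \<open>a\<close> and \<open>b\<close>. Such a matrix is similar to \<open>\<Delta>\<close> because
  \<open>f \<mapsto> y f(h) - x f(h + 1)\<close> is surjective on \<open>\<complex>[h]\<close> for nonzero \<open>x\<close> and \<open>y\<close>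
  (\<open>twisted_difference_surj\<close>).\<close>

section \<open>Two by two matrices and their shift\<close>

definition mat2 :: "complex poly \<Rightarrow> complex poly \<Rightarrow> complex poly \<Rightarrow> complex poly \<Rightarrow> pmat" where
  "mat2 p q r s = vector [vector [p, q], vector [r, s]]"

lemma mat2_nth [simp]:
  "mat2 p q r s $ 1 $ 1 = p" "mat2 p q r s $ 1 $ 2 = q"
  "mat2 p q r s $ 2 $ 1 = r" "mat2 p q r s $ 2 $ 2 = s"
  by (simp_all add: mat2_def)

lemma pmat_eq_iff:
  "(A :: pmat) = B \<longleftrightarrow> A$1$1 = B$1$1 \<and> A$1$2 = B$1$2 \<and> A$2$1 = B$2$1 \<and> A$2$2 = B$2$2"
  by (auto simp: vec_eq_iff forall_2)

lemma mat2_mult: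
  "mat2 p q r s ** mat2 p' q' r' s' =
     mat2 (p * p' + q * r') (p * q' + q * s') (r * p' + s * r') (r * q' + s * s')"
  by (simp add: pmat_eq_iff matrix_matrix_mult_def sum_2)

lemma mat2_eq_iff:
  "mat2 p q r s = mat2 p' q' r' s' \<longleftrightarrow> p = p' \<and> q = q' \<and> r = r' \<and> s = s'"
  by (auto simp: pmat_eq_iff)

lemma mat2_cases: obtains p q r s where "A = mat2 p q r s"
proof
  show "A = mat2 (A$1$1) (A$1$2) (A$2$1) (A$2$2)"
    by (simp add: pmat_eq_iff)
qed

lemma mat2_uminus: "- mat2 p q r s = mat2 (- p) (- q) (- r) (- s)"
  by (simp add: pmat_eq_iff)

lemma mat_mat2: "mat c = mat2 c 0 0 c"
  by (simp add: pmat_eq_iff mat_def)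

lemma E_mat2: "E u = mat2 u 1 (- 1) 0"
  by (simp add: E_def mat2_def)

lemma diag2_mat2: "diag2 x y = mat2 [:x:] 0 0 [:y:]"
  by (simp add: diag2_def mat2_def)

lemma shift_simps [simp]:
  "shift 0 = 0" "shift 1 = 1" "shift [:c:] = [:c:]" "shift (- p) = - shift p"
  "shift (p + q) = shift p + shift q" "shift (p - q) = shift p - shift q"
  "shift (p * q) = shift p * shift q" "shift (smult c p) = smult c (shift p)"
  by (simp_all add: shift_def pcompose_add pcompose_diff pcompose_uminus pcompose_mult
        pcompose_smult pcompose_const pcompose_1)

lemma shift_mat_mat2: "shift_mat (mat2 p q r s) = mat2 (shift p) (shift q) (shift r) (shift s)"
  by (simp add: pmat_eq_iff shift_mat_def)

lemmas mat2_simps = mat2_mult mat2_eq_iff mat2_uminus mat_mat2 E_mat2 diag2_mat2 shift_mat_mat2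

lemma shift_mat_mult: "shift_mat (A ** B) = shift_mat A ** shift_mat B"
  by (cases A rule: mat2_cases; cases B rule: mat2_cases) (simp add: mat2_simps)

lemma shift_mat_1 [simp]: "shift_mat (mat 1) = mat 1"
  by (simp add: mat2_simps)

lemma invertible_shift_mat: "invertible A \<Longrightarrow> invertible (shift_mat A)"
  unfolding invertible_def
proof (elim exE conjE)
  fix B assume "A ** B = mat 1" "B ** A = mat 1"
  then have "shift_mat A ** shift_mat B = mat 1 \<and> shift_mat B ** shift_mat A = mat 1"
    by (simp flip: shift_mat_mult)
  then show "\<exists>B. shift_mat A ** B = mat 1 \<and> B ** shift_mat A = mat 1" ..
qed

definition lower :: "complex \<Rightarrow> pmat" where
  "lower t = mat2 1 0 [:t:] 1"

lemma invertible_E: "invertible (E u)"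
  unfolding invertible_def
  by (rule exI[of _ "mat2 0 (- 1) 1 u"]) (simp add: mat2_simps)

lemma invertible_lower: "invertible (lower t)"
  unfolding invertible_def
  by (rule exI[of _ "lower (- t)"]) (simp add: mat2_simps lower_def one_pCons)

text \<open>Stated without inverses, similarity of explicit words becomes a polynomial identity between matrix
  entries. For invertible \<open>P\<close> the matrices \<open>A\<close> and \<open>B\<close> determine each other.\<close>

definition intertwines :: "pmat \<Rightarrow> pmat \<Rightarrow> pmat \<Rightarrow> bool" where
  "intertwines P A B \<longleftrightarrow> A ** shift_mat P = P ** B"

lemma matrix_inv_mult:
  fixes P :: pmat
  assumes "invertible P"
  shows "P ** matrix_inv P = mat 1" "matrix_inv P ** P = mat 1"
  using someI_ex[OF assms[unfolded invertible_def]] by (auto simp: matrix_inv_def)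

lemma matrix_cancel_left:
  fixes P :: pmat
  assumes "invertible P"
  shows "matrix_inv P ** (P ** A) = A" "P ** (matrix_inv P ** A) = A"
  by (simp_all add: matrix_mul_assoc matrix_inv_mult[OF assms])

lemma sigma_inv_similar_iff:
  "sigma_inv_similar A B \<longleftrightarrow> (\<exists>P. invertible P \<and> intertwines P A B)"
proof -
  have "B = matrix_inv P ** A ** shift_mat P \<longleftrightarrow> intertwines P A B" if "invertible P" for P
    unfolding intertwines_def matrix_mul_assoc[symmetric]
    using matrix_cancel_left[OF that] by metis
  then show ?thesis by (auto simp: sigma_inv_similar_def)
qed

lemma intertwines_comp:
  assumes "intertwines P A B" "intertwines Q B C"
  shows "intertwines (P ** Q) A C"
proof -
  have "A ** shift_mat (P ** Q) = (A ** shift_mat P) ** shift_mat Q"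
    by (simp add: shift_mat_mult matrix_mul_assoc)
  also have "\<dots> = P ** (B ** shift_mat Q)"
    using assms(1) by (simp add: intertwines_def matrix_mul_assoc)
  also have "\<dots> = (P ** Q) ** C"
    using assms(2) by (simp add: intertwines_def matrix_mul_assoc)
  finally show ?thesis by (simp add: intertwines_def)
qed

lemma similar_if_intertwines:
  assumes "invertible P" "intertwines P A B" "sigma_inv_similar B C"
  shows "sigma_inv_similar A C"
  using assms intertwines_comp invertible_mult unfolding sigma_inv_similar_iff by blast

lemma intertwines_unique:
  assumes "invertible P" "intertwines P A C" "intertwines P B C"
  shows "A = B"
proof -
  have "A ** shift_mat P ** matrix_inv (shift_mat P) = B ** shift_mat P ** matrix_inv (shift_mat P)"
    using assms(2,3) by (simp add: intertwines_def)
  then show ?thesis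
    by (simp add: matrix_inv_mult[OF invertible_shift_mat[OF assms(1)]] flip: matrix_mul_assoc)
qed

text \<open>This splits off the outermost factor of a transforming matrix, which allows an induction along a
  factorization.\<close>

lemma intertwines_factor:
  assumes "invertible P" "intertwines (P ** Q) A C"
  obtains B where "intertwines P A B" "intertwines Q B C"
proof
  let ?B = "matrix_inv P ** A ** shift_mat P"
  show "intertwines P A ?B"
    by (simp add: intertwines_def matrix_cancel_left[OF assms(1)] flip: matrix_mul_assoc)
  have "?B ** shift_mat Q = matrix_inv P ** (A ** shift_mat (P ** Q))"
    by (simp add: shift_mat_mult flip: matrix_mul_assoc)
  also have "\<dots> = Q ** C"
    using assms(2)
    by (simp add: intertwines_def matrix_cancel_left[OF assms(1)] flip: matrix_mul_assoc)
  finally show "intertwines Q ?B C" by (simp add: intertwines_def)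
qed

section \<open>Words that end in \<open>E(0)\<close>\<close>

definition word :: "complex poly \<Rightarrow> complex \<Rightarrow> complex \<Rightarrow> pmat \<Rightarrow> pmat" where
  "word s x y W = mat s ** diag2 x y ** W ** E 0"

lemma smult_conv: "smult c p = [:c:] * p" by simp

text \<open>Conjugation of a word by \<open>E(- u)\<close> produces the mirrored pair of factors. On the right,
  \<open>E(u(h + 1)) E(0) E(- u(h + 1)) = - E(0)\<close> accounts for the change of sign; on the left, \<open>E(- u)\<close>
  passes the diagonal prefix by \<open>E(v) diag(x, y) = diag(y, x) E(v x / y)\<close>.\<close>

lemma word_extend:
  assumes "x = c * y"
  shows "intertwines (E (- u)) (word (- s) y x (E (- smult c u) ** W ** E (shift u))) (word s x y W)"
proof -
  obtain p q r t where W: "W = mat2 p q r t" by (rule mat2_cases)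
  have x: "[:x:] = [:c:] * [:y:]" using assms by (simp add: mult.commute)
  show ?thesis
    unfolding intertwines_def word_def W smult_conv[of c]
    by (simp add: mat2_simps x del: mult_pCons_left mult_pCons_right) (intro conjI; algebra)
qed

lemma word_E0:
  "intertwines (E 0) (mat s ** diag2 y x ** E 0 ** W) (word s x y W)"
proof -
  obtain p q r t where W: "W = mat2 p q r t" by (rule mat2_cases)
  show ?thesis
    unfolding intertwines_def word_def W
    by (simp add: mat2_simps del: mult_pCons_left mult_pCons_right)
qed

text \<open>The matrix \<open>lower t\<close> changes both ends of a word. On the right it replaces \<open>E(0)\<close> by \<open>E(- t)\<close>, since
  \<open>E(0) = E(- t) lower(t)\<close>. On the left it passes the prefix \<open>diag(x, y)\<close> and becomes
  \<open>lower(t x / y) = lower(\<eta>)\<close>, and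
  \<open>lower(\<eta>) E(w) = - diag(\<eta>\<^sup>-\<^sup>1, \<eta>) E(- \<eta>) E(w - \<eta>\<^sup>-\<^sup>1)\<close>.\<close>

lemma word_lower:
  assumes "x = c * y" "\<eta> = t * c" "\<eta> \<noteq> 0"
  shows "intertwines (lower t)
           (mat (- s) ** diag2 (x * inverse \<eta>) (y * \<eta>) ** E [:- \<eta>:] ** E (w - [:inverse \<eta>:]) ** W ** E [:- t:])
           (word s x y (E w ** W))"
proof -
  obtain p q r t' where W: "W = mat2 p q r t'" by (rule mat2_cases)
  have "t * (c * inverse \<eta>) = 1" using assms by (metis mult.assoc right_inverse)
  then have e: "[:t:] * ([:c:] * [:inverse \<eta>:]) = (1 :: complex poly)"
    by (simp add: one_pCons mult_ac)
  have x: "[:x:] = [:c:] * [:y:]" "[:\<eta>:] = [:t:] * [:c:]" "[:- t:] = - [:t:]"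
      "[:- \<eta>:] = - ([:t:] * [:c:])"
      "[:x * inverse \<eta>:] = [:c:] * [:y:] * [:inverse \<eta>:]" "[:y * \<eta>:] = [:y:] * ([:t:] * [:c:])"
    using assms by (simp_all add: mult_ac)
  show ?thesis
    unfolding intertwines_def word_def lower_def W
    by (simp add: mat2_simps x del: mult_pCons_left mult_pCons_right minus_pCons)
      (insert e, intro conjI; algebra)
qed

section \<open>The families of words\<close>

text \<open>A middle factor surrounded by mirrored pairs, the outermost pair having the largest index. Words
  \<open>D\<close> and \<open>G\<close> consist of such a tower between a prefix and a suffix; in \<open>K\<close> and \<open>Z\<close> the left factor of
  the outermost pair is changed by a constant.\<close>

definition tower :: "(nat \<Rightarrow> complex) \<Rightarrow> pmat \<Rightarrow> nat \<Rightarrow> (nat \<Rightarrow> complex poly) \<Rightarrow> pmat" where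
  "tower c M k u =
     prod_down 2 k (\<lambda>i. E (- smult (c i) (u i))) ** M ** prod_up 2 k (\<lambda>j. E (shift (u j)))"

lemma mat_prod_list_append: "mat_prod_list (Ms @ Ns) = mat_prod_list Ms ** mat_prod_list Ns"
  by (induction Ms) (simp_all add: mat_prod_list_def matrix_mul_assoc)

lemma prod_up_Suc: "n \<le> Suc m \<Longrightarrow> prod_up n (Suc m) F = prod_up n m F ** F (Suc m)"
  by (simp add: prod_up_def mat_prod_list_append) (simp add: mat_prod_list_def)

lemma prod_down_Suc: "n \<le> Suc m \<Longrightarrow> prod_down n (Suc m) F = F (Suc m) ** prod_down n m F"
  by (simp add: prod_down_def mat_prod_list_def)

lemma tower_1: "tower c M (Suc 0) u = M"
  by (simp add: tower_def prod_up_def prod_down_def mat_prod_list_def)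

lemma tower_Suc:
  "k \<ge> 1 \<Longrightarrow> tower c M (Suc k) u =
     E (- smult (c (Suc k)) (u (Suc k))) ** tower c M k u ** E (shift (u (Suc k)))"
  by (simp add: tower_def prod_up_Suc prod_down_Suc matrix_mul_assoc)

lemma tower_cong:
  "(\<And>i. i \<in> {2..k} \<Longrightarrow> u i = v i) \<Longrightarrow> tower c M k u = tower c M k v"
  unfolding tower_def prod_up_def prod_down_def
  by (intro arg_cong2[of _ _ _ _ "(**)"] arg_cong[of _ _ mat_prod_list]) auto

text \<open>Both \<open>diag(x, y)\<^bsub>[n]\<^esub>\<close> and the exponents \<open>(-1)\<^sup>n\<close> depend on the parity of \<open>n\<close> only. Expressing them
  by one function reduces the comparison of prefixes to parity.\<close>

definition alt :: "'a \<Rightarrow> 'a \<Rightarrow> nat \<Rightarrow> 'a" where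
  "alt x y n = (if even n then x else y)"

lemma alt_Suc: "alt x y (Suc n) = alt y x n"
  by (simp add: alt_def)

lemma diag2_br_alt: "diag2_br x y (int n) = diag2 (alt x y n) (alt y x n)"
  by (simp add: diag2_br_def alt_def)

lemma powi_alt: "x powi ((- 1) ^ n) = alt x (inverse x) n" for x :: complex
  by (simp add: alt_def minus_one_power_iff power_int_minus)

lemma mat_pow_01 [simp]: "mat_pow M 0 = mat 1" "mat_pow M (Suc 0) = M"
  by (simp_all add: mat_pow_def)

lemma diag2_mult: "diag2 x y ** diag2 x' y' = diag2 (x * x') (y * y')"
  by (simp add: mat2_simps mult.commute)

lemma uminus_eq_mat: "- M = mat (- 1) ** (M :: pmat)"
proof -
  obtain p q r s where "M = mat2 p q r s" by (rule mat2_cases)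
  then show ?thesis by (simp add: mat2_simps)
qed

lemma D_form_word:
  "D_form a b 1 d k u = word ((- 1) ^ k) (alt a b (k + 1 + d)) (alt b a (k + 1 + d))
     (tower (\<lambda>i. (a / b) powi ((- 1) ^ (i + d))) (E (u 1)) k u)"
  by (simp add: D_form_def word_def diag2_br_alt tower_def flip: matrix_mul_assoc
      del: of_nat_add of_nat_Suc)

lemma G_form_word:
  "G_form a b 1 \<beta> k u =
     word ((- 1) ^ (k + 1)) (alt (a * \<beta>) (b * inverse \<beta>) k) (alt (b * inverse \<beta>) (a * \<beta>) k)
     (tower (\<lambda>i. (\<beta>\<^sup>2 * (a / b)) powi ((- 1) ^ (i + 1)))
       (E (- smult (\<beta>\<^sup>2 * (a / b)) (u 1) - [:\<beta>:]) ** E (shift (u 1) - [:inverse \<beta>:])) k u)"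
proof -
  have *: "M ** diag2_br a b (int (k + 1 - 1)) **
      diag2 (\<beta> powi ((- 1) ^ (k + 1 - 1))) (\<beta> powi ((- 1) ^ (k + 1)))
      = M ** diag2 (alt (a * \<beta>) (b * inverse \<beta>) k) (alt (b * inverse \<beta>) (a * \<beta>) k)" for M
    unfolding diag2_br_alt diag2_mult powi_alt matrix_mul_assoc[symmetric] by (simp add: alt_def)
  show ?thesis
    unfolding G_form_def * by (simp add: word_def tower_def matrix_mul_assoc)
qed

lemma D_form_step:
  assumes "a \<noteq> 0" "b \<noteq> 0" "k \<ge> 1"
  shows "intertwines (E (- u (Suc k))) (D_form a b 1 d (Suc k) u) (D_form a b 1 d k u)"
proof -
  have "alt a b (k + 1 + d) = (a / b) powi ((- 1) ^ (Suc k + d)) * alt b a (k + 1 + d)"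
    using assms by (auto simp: alt_def powi_alt)
  moreover have "alt x y (Suc k + 1 + d) = alt y x (k + 1 + d)" for x y :: complex
    by (simp add: alt_def)
  moreover have "(- 1) ^ Suc k = - ((- 1) ^ k :: complex poly)" by simp
  ultimately show ?thesis
    by (simp only: D_form_word tower_Suc[OF assms(3)] word_extend)
qed

lemma G_form_step:
  assumes "a \<noteq> 0" "b \<noteq> 0" "\<beta> \<noteq> 0" "k \<ge> 1"
  shows "intertwines (E (- u (Suc k))) (G_form a b 1 \<beta> (Suc k) u) (G_form a b 1 \<beta> k u)"
proof -
  have "alt (a * \<beta>) (b * inverse \<beta>) k =
      (\<beta>\<^sup>2 * (a / b)) powi ((- 1) ^ (Suc k + 1)) * alt (b * inverse \<beta>) (a * \<beta>) k"
    using assms by (auto simp: alt_def powi_alt field_simps power2_eq_square)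
  moreover have "(- 1) ^ (Suc k + 1) = - ((- 1) ^ (k + 1) :: complex poly)" by simp
  ultimately show ?thesis
    by (simp only: G_form_word tower_Suc[OF assms(4)] alt_Suc word_extend)
qed

lemma D_form_zero: "intertwines (E 0) (D_form a b 0 d k u) (D_form a b 1 d k u)"
proof -
  have "D_form a b 0 d k u = mat ((- 1) ^ k) ** diag2 (alt b a (k + 1 + d)) (alt a b (k + 1 + d)) ** E 0 **
     tower (\<lambda>i. (a / b) powi ((- 1) ^ (i + d))) (E (u 1)) k u"
    by (simp add: D_form_def diag2_br_alt tower_def alt_Suc matrix_mul_assoc del: of_nat_add of_nat_Suc)
  then show ?thesis
    by (simp only: D_form_word word_E0)
qed

lemma G_form_zero: "intertwines (E 0) (G_form a b 0 \<beta> k u) (G_form a b 1 \<beta> k u)"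
proof -
  have *: "M ** diag2_br a b (int (k + 1 - 0)) **
      diag2 (\<beta> powi ((- 1) ^ (k + 1 - 0))) (\<beta> powi ((- 1) ^ (k + 0)))
      = M ** diag2 (alt (b * inverse \<beta>) (a * \<beta>) k) (alt (a * \<beta>) (b * inverse \<beta>) k)" for M
    unfolding diag2_br_alt diag2_mult powi_alt matrix_mul_assoc[symmetric] by (simp add: alt_def)
  have "G_form a b 0 \<beta> k u =
     mat ((- 1) ^ (k + 1)) ** diag2 (alt (b * inverse \<beta>) (a * \<beta>) k) (alt (a * \<beta>) (b * inverse \<beta>) k) ** E 0 **
     (tower (\<lambda>i. (\<beta>\<^sup>2 * (a / b)) powi ((- 1) ^ (i + 1)))
       (E (- smult (\<beta>\<^sup>2 * (a / b)) (u 1) - [:\<beta>:]) ** E (shift (u 1) - [:inverse \<beta>:])) k u)"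
    unfolding G_form_def * by (simp add: tower_def matrix_mul_assoc)
  then show ?thesis
    by (simp only: G_form_word word_E0)
qed

text \<open>For \<open>k \<ge> 2\<close> the summand \<open>- \<eta>\<^sup>-\<^sup>1\<close> created by \<open>lower t\<close> is visible in the factor with \<open>u\<^sub>k\<close>. For
  \<open>k = 1\<close> the definition of \<open>K\<close> absorbs it into \<open>u\<^sub>1\<close>, whence the case distinction.\<close>

lemma K_form_lower:
  assumes "a \<noteq> 0" "b \<noteq> 0" "k \<ge> 1" "t \<noteq> 0" "\<eta> = t * (a / b) powi ((- 1) ^ (k + 1 + e))" "e \<in> {0, 1}"
  shows "intertwines (lower t) (K_form a b e \<eta> k u)
           (D_form a b 1 e k (if k = 1 then (\<lambda>_. u 1 + [:inverse \<eta>:]) else u))"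
proof -
  let ?x = "alt a b (k + 1 + e)" and ?y = "alt b a (k + 1 + e)"
  have x: "?x = (a / b) powi ((- 1) ^ (k + 1 + e)) * ?y"
    using assms by (auto simp: alt_def powi_alt)
  have \<eta>: "\<eta> \<noteq> 0" using assms by auto
  have diag: "diag2_br a b (int (k + 1 + e)) ** diag2 (inverse \<eta>) \<eta> = diag2 (?x * inverse \<eta>) (?y * \<eta>)"
    by (simp only: diag2_br_alt diag2_mult)
  have par: "alt X Y (k + 1 - e) = alt X Y (k + 1 + e)" for X Y :: complex
    using assms(6) by (auto simp: alt_def)
  have t: "\<eta> * (b / a) powi ((- 1) ^ (k + 1 - e)) = t"
    using assms(1,2,6) unfolding powi_alt par assms(5) by (auto simp: alt_def)
  show ?thesis
  proof (cases "k = 1")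
    case True
    have "K_form a b e \<eta> k u = mat (- ((- 1) ^ k)) ** diag2 (?x * inverse \<eta>) (?y * \<eta>) ** E [:- \<eta>:] **
        E ((u 1 + [:inverse \<eta>:]) - [:inverse \<eta>:]) ** mat 1 ** E [:- t:]"
      using assms(6) t unfolding diag[symmetric] K_form_def
      by (auto simp: True diag2_br_def powi_alt alt_def matrix_mul_assoc)
    moreover have "D_form a b 1 e k (if k = 1 then (\<lambda>_. u 1 + [:inverse \<eta>:]) else u) =
        word ((- 1) ^ k) ?x ?y (E (u 1 + [:inverse \<eta>:]) ** mat 1)"
      by (simp only: D_form_word True tower_1[unfolded One_nat_def[symmetric]] if_True matrix_mul_rid simp_thms)
    ultimately show ?thesis
      by (simp only: word_lower[OF x assms(5) \<eta>])
  next
    case False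
    then obtain m where m: "k = Suc m" "m \<ge> 1" using assms(3) by (cases k) auto
    let ?c = "\<lambda>i. (a / b) powi ((- 1) ^ (i + e))"
    have "diag2_br a b (int (k + 1 - e)) = diag2_br a b (int (k + 1 + e))"
      by (simp only: diag2_br_alt par)
    then have "K_form a b e \<eta> k u = mat (- ((- 1) ^ k)) ** diag2 (?x * inverse \<eta>) (?y * \<eta>) ** E [:- \<eta>:] **
        E (- smult (?c k) (u k) - [:inverse \<eta>:]) ** (tower ?c (E (u 1)) m u ** E (shift (u k))) ** E [:- t:]"
      using False unfolding diag[symmetric] K_form_def t
      by (simp add: m(1) tower_def prod_up_Suc m(2) matrix_mul_assoc)
    moreover have "tower ?c (E (u 1)) k u =
        E (- smult (?c k) (u k)) ** (tower ?c (E (u 1)) m u ** E (shift (u k)))"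
      using m by (simp add: tower_Suc matrix_mul_assoc)
    ultimately show ?thesis using False
      by (simp only: D_form_word if_False word_lower[OF x assms(5) \<eta>])
  qed
qed

lemma Z_form_lower:
  assumes "a \<noteq> 0" "b \<noteq> 0" "\<beta> \<noteq> 0" "k \<ge> 1" "t \<noteq> 0"
    "\<eta> = t * (\<beta>\<^sup>2 * (a / b)) powi ((- 1) ^ k)"
  shows "intertwines (lower t) (Z_form a b \<beta> \<eta> k u) (G_form a b 1 \<beta> k u)"
proof -
  let ?x = "alt (a * \<beta>) (b * inverse \<beta>) k" and ?y = "alt (b * inverse \<beta>) (a * \<beta>) k"
  let ?c = "\<lambda>i. (\<beta>\<^sup>2 * (a / b)) powi ((- 1) ^ (i + 1))"
  have x: "?x = (\<beta>\<^sup>2 * (a / b)) powi ((- 1) ^ k) * ?y"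
    using assms by (auto simp: alt_def powi_alt field_simps power2_eq_square)
  have \<eta>: "\<eta> \<noteq> 0" using assms by auto
  have t: "\<eta> * (\<beta>\<^sup>2 * (a / b)) powi ((- 1) ^ (k + 1)) = t"
    using assms(1-3) unfolding powi_alt assms(6) by (auto simp: alt_def)
  show ?thesis
  proof (cases "k = 1")
    case True
    have "Z_form a b \<beta> \<eta> k u = mat (- ((- 1) ^ (k + 1))) ** diag2 (?x * inverse \<eta>) (?y * \<eta>) ** E [:- \<eta>:] **
        E (- smult (\<beta>\<^sup>2 * (a / b)) (u 1) - [:\<beta>:] - [:inverse \<eta>:]) ** E (shift (u 1) - [:inverse \<beta>:]) ** E [:- t:]"
      using t unfolding Z_form_def uminus_eq_mat
      by (simp add: True alt_def mult_ac power_int_minus matrix_mul_assoc)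
    with word_lower[OF x assms(6) \<eta>] show ?thesis
      by (simp only: G_form_word True tower_1[unfolded One_nat_def[symmetric]])
  next
    case False
    then obtain m where m: "k = Suc m" "m \<ge> 1" using assms(4) by (cases k) auto
    let ?M = "E (- smult (\<beta>\<^sup>2 * (a / b)) (u 1) - [:\<beta>:]) ** E (shift (u 1) - [:inverse \<beta>:])"
    have *: "M ** diag2_br a b (int k) **
       diag2 (inverse \<eta> * \<beta> powi ((- 1) ^ k)) (\<eta> * \<beta> powi ((- 1) ^ (k + 1)))
       = M ** diag2 (?x * inverse \<eta>) (?y * \<eta>)" for M
      unfolding diag2_br_alt diag2_mult powi_alt matrix_mul_assoc[symmetric]
      by (simp add: alt_def mult_ac)
    have "Z_form a b \<beta> \<eta> k u = mat (- ((- 1) ^ (k + 1))) ** diag2 (?x * inverse \<eta>) (?y * \<eta>) ** E [:- \<eta>:] **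
        E (- smult (?c k) (u k) - [:inverse \<eta>:]) ** (tower ?c ?M m u ** E (shift (u k))) ** E [:- t:]"
      using False unfolding Z_form_def t *
      by (simp add: m(1) tower_def prod_up_Suc m(2) matrix_mul_assoc)
    moreover have "tower ?c ?M k u = E (- smult (?c k) (u k)) ** (tower ?c ?M m u ** E (shift (u k)))"
      using m by (simp add: tower_Suc matrix_mul_assoc)
    ultimately show ?thesis
      by (simp only: G_form_word word_lower[OF x assms(6) \<eta>])
  qed
qed

section \<open>Triangular and constant matrices\<close>

lemma coeff_shift_monom:
  "coeff (shift (monom 1 n)) i = of_nat (n choose i)"
proof -
  have "shift (monom 1 n) = [:1, 1:] ^ n"
    by (induction n) (simp_all add: monom_0 monom_Suc shift_def pcompose_pCons)
  then show ?thesis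
    using coeff_linear_poly_power[of i n 1 "1 :: complex"]
    by (cases "i \<le> n") (auto simp: coeff_eq_0 degree_linear_power binomial_eq_0)
qed

text \<open>If \<open>x \<noteq> y\<close>, the operator \<open>f \<mapsto> y f(h) - x f(h + 1)\<close> preserves degrees. If \<open>x = y\<close>, the
  leading terms cancel and it lowers positive degrees by one, because \<open>(h + 1)\<^sup>n\<^sup>+\<^sup>1 - h\<^sup>n\<^sup>+\<^sup>1\<close> has
  leading term \<open>(n + 1) h\<^sup>n\<close>. In both cases a preimage is found by removing leading terms.\<close>

lemma twisted_difference_surj:
  assumes "x \<noteq> 0" "y \<noteq> 0"
  shows "\<exists>f. smult y f - smult x (shift f) = w"
proof -
  have "\<forall>w. (\<forall>i\<ge>n. coeff w i = 0) \<longrightarrow> (\<exists>f. smult y f - smult x (shift f) = w)" for n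
  proof (induction n)
    case 0
    show ?case
    proof (intro allI impI)
      fix w :: "complex poly" assume "\<forall>i\<ge>0. coeff w i = 0"
      then have "w = 0" by (simp add: poly_eq_iff)
      then show "\<exists>f. smult y f - smult x (shift f) = w"
        by (intro exI[of _ 0]) simp
    qed
  next
    case (Suc n)
    show ?case
    proof (intro allI impI)
      fix w :: "complex poly" assume w: "\<forall>i\<ge>Suc n. coeff w i = 0"
      \<comment> \<open>The image of \<open>g\<close> is monic of degree \<open>n\<close>.\<close>
      define g :: "complex poly" where
        "g = (if x = y then smult (- 1 / (x * of_nat (Suc n))) (monom 1 (Suc n))
              else smult (1 / (y - x)) (monom 1 n))"
      let ?r = "w - smult (coeff w n) (smult y g - smult x (shift g))"
      have top: "coeff (smult y g - smult x (shift g)) i = (if i = n then 1 else 0)" if "i \<ge> n" for i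
      proof (cases "x = y")
        case True
        have "i = n \<or> i = Suc n \<or> i > Suc n" using that by auto
        moreover have "x + x * of_nat n \<noteq> 0"
          using assms(1) of_nat_neq_0[of n, where ?'a = complex]
          by (simp add: ring_distribs(1)[of x 1, simplified, symmetric])
        ultimately show ?thesis using True assms
          by (elim disjE) (auto simp: g_def coeff_shift_monom binomial_eq_0 field_simps)
      next
        case False
        have "i = n \<or> i > n" using that by auto
        moreover have "y / (y - x) - x / (y - x) = 1"
          using False by (simp flip: diff_divide_distrib)
        ultimately show ?thesis using False
          by (elim disjE) (auto simp: g_def coeff_shift_monom binomial_eq_0)
      qed
      have "\<forall>i\<ge>n. coeff ?r i = 0"
      proof (intro allI impI)
        fix i assume "i \<ge> n"
        then show "coeff ?r i = 0"
          using top[of i] w by (cases "i = n") auto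
      qed
      then obtain f where f: "smult y f - smult x (shift f) = ?r"
        using Suc.IH by blast
      show "\<exists>f. smult y f - smult x (shift f) = w"
        by (rule exI[of _ "f + smult (coeff w n) g"])
          (use f in \<open>simp add: smult_add_right smult_diff_right algebra_simps\<close>)
    qed
  qed
  then show ?thesis
    by (metis coeff_eq_0 Suc_le_eq)
qed

definition upper :: "complex \<Rightarrow> complex poly \<Rightarrow> complex \<Rightarrow> pmat" where
  "upper x w y = mat2 [:x:] w 0 [:y:]"

text \<open>Conjugation by a unitriangular matrix with corner \<open>f\<close> changes the corner by \<open>y f(h) - x f(h + 1)\<close>,
  and \<open>E(0)\<close> exchanges the diagonal entries.\<close>

lemma upper_similar:
  assumes "a \<noteq> 0" "b \<noteq> 0" "(x, y) \<in> {(a, b), (b, a)}"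
  shows "sigma_inv_similar (upper x w y) (diag2 a b)"
proof -
  from assms have "x \<noteq> 0" "y \<noteq> 0" by auto
  from twisted_difference_surj[OF this] obtain f where "smult y f - smult x (shift f) = w" by blast
  then have "intertwines (mat2 1 f 0 1) (upper x w y) (diag2 x y)"
    by (auto simp: intertwines_def upper_def mat2_simps)
  moreover have "invertible (mat2 1 f 0 1)"
    unfolding invertible_def by (rule exI[of _ "mat2 1 (- f) 0 1"]) (simp add: mat2_simps)
  moreover have "sigma_inv_similar (diag2 x y) (diag2 a b)"
  proof (cases "(x, y) = (a, b)")
    case True
    then show ?thesis unfolding sigma_inv_similar_iff intertwines_def
      by (intro exI[of _ "mat 1"]) (auto simp: invertible_def)
  next
    case False
    then show ?thesis using assms(3) invertible_E[of 0] unfolding sigma_inv_similar_iff intertwines_def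
      by (intro exI[of _ "E 0"]) (auto simp: mat2_simps)
  qed
  ultimately show ?thesis by (blast intro: similar_if_intertwines)
qed

lemma trace_det_diagonal:
  fixes p s a b :: complex
  assumes "p + s = a + b" "p * s = a * b"
  shows "(p, s) \<in> {(a, b), (b, a)}"
proof -
  have "(p - a) * (p - b) = 0" using assms by algebra
  then show ?thesis using assms(1) by auto
qed

text \<open>Either \<open>E(0)\<close> or a suitable \<open>lower t\<close> brings the matrix into upper triangular form; for \<open>q \<noteq> 0\<close> the
  column \<open>(1, t)\<close> with \<open>t = (s - b) / q\<close> is an eigenvector for \<open>a\<close>.\<close>

lemma const_similar:
  assumes "a \<noteq> 0" "b \<noteq> 0" "p + s = a + b" "p * s - q * r = a * b"
  shows "sigma_inv_similar (mat2 [:p:] [:q:] [:r:] [:s:]) (diag2 a b)"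
proof (cases "q = 0")
  case True
  have "intertwines (E 0) (mat2 [:p:] [:q:] [:r:] [:s:]) (upper s [:- r:] p)"
    by (simp add: intertwines_def upper_def mat2_simps True)
  moreover have "(s, p) \<in> {(a, b), (b, a)}"
    using trace_det_diagonal[of s p a b] assms True by (simp add: add.commute mult.commute)
  ultimately show ?thesis
    using upper_similar[OF assms(1,2)] invertible_E similar_if_intertwines by blast
next
  case False
  define t where "t = (s - b) / q"
  have "t * q = s - b" using False by (simp add: t_def)
  moreover from this have "q * (a * t) = q * (r + s * t)" using assms(3,4) by algebra
  then have "a * t = r + s * t" using False by simp
  moreover have "p = a - t * q" using assms(3) \<open>t * q = s - b\<close> by algebra
  ultimately have "intertwines (lower t) (mat2 [:p:] [:q:] [:r:] [:s:]) (upper a [:q:] b)"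
    using assms(3) by (simp add: intertwines_def lower_def upper_def mat2_simps algebra_simps)
  then show ?thesis
    using upper_similar[OF assms(1,2)] invertible_lower similar_if_intertwines by blast
qed

lemma D_form_base:
  "D_form a b 1 d 1 u = upper (alt a b d) (- smult (alt a b d) (u 1)) (alt b a d)"
  unfolding D_form_word upper_def
  by (simp add: tower_1[simplified] word_def mat2_simps alt_def)

text \<open>The computation behind \<open>G_form_base\<close>, over indeterminates: \<open>R\<close> and \<open>AB\<close> stand for \<open>b / \<beta>\<close> and
  \<open>a \<beta>\<close>, \<open>g\<close> for \<open>\<beta>\<^sup>2 a / b\<close>, \<open>\<beta>'\<close> for \<open>\<beta>\<^sup>-\<^sup>1\<close> and \<open>v'\<close> for \<open>v(h + 1)\<close>.\<close>

lemma G_form_base_identity: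
  assumes "R * g = AB" "R * \<beta> = B" "AB * \<beta>' = A" "AB * c = A - X" "(A + B - X) * (\<beta>' - c) = R"
  shows "mat 1 ** mat2 R 0 0 AB ** (E (- (g * (c - v)) - \<beta>) ** E (c - v' - \<beta>')) ** E 0 ** mat2 v' 1 (- 1) 0
    = E v ** mat2 X (- AB) 0 (A + B - X)"
proof -
  define p where "p = - (g * (c - v)) - \<beta>"
  have p: "R * p = AB * v - (A + B - X)"
    using assms(4) by (simp add: p_def algebra_simps flip: assms(1,2))
  then have "R * p * (c - \<beta>') = R - v * X"
    using assms(3-5) by algebra
  with p assms(3,4) show ?thesis
    unfolding p_def[symmetric]
    by (simp add: mat2_simps) (intro conjI; algebra)
qed

text \<open>A nonzero constant corner is where the parameter \<open>\<beta>\<close> comes from. Both orders of the diagonal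
  entries lead to the same family, with \<open>u\<^sub>1\<close> differing by a constant. This is why \<open>G\<close>, unlike \<open>D\<close>, has
  no parameter \<open>\<delta>\<close>.\<close>

lemma G_form_base:
  assumes "a \<noteq> 0" "b \<noteq> 0" "\<beta> \<noteq> 0" "(x, y) \<in> {(a, b), (b, a)}" "u 1 = [:(a - x) / (a * \<beta>):] - v"
  shows "intertwines (E v) (G_form a b 1 \<beta> 1 u) (upper x [:- (a * \<beta>):] y)"
proof -
  define c where "c = (a - x) / (a * \<beta>)"
  define g where "g = \<beta>\<^sup>2 * (a / b)"
  have y: "[:y:] = [:a:] + [:b:] - [:x:]" using assms(4) by auto
  have "[:b * inverse \<beta>:] * [:g:] = [:a * \<beta>:]" "[:b * inverse \<beta>:] * [:\<beta>:] = [:b:]"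
    "[:a * \<beta>:] * [:inverse \<beta>:] = [:a:]" "[:a * \<beta>:] * [:c:] = [:a:] - [:x:]"
    "[:- (a * \<beta>):] = - [:a * \<beta>:]"
    using assms(1-3) by (simp_all add: c_def g_def power2_eq_square)
  note rels = this
  have "x * y = a * b" using assms(4) by auto
  then have "y * (inverse \<beta> - c) = b * inverse \<beta>"
    using assms(1-3) by (simp add: c_def field_simps)
  then have rel: "([:a:] + [:b:] - [:x:]) * ([:inverse \<beta>:] - [:c:]) = [:b * inverse \<beta>:]"
    unfolding y[symmetric] by (simp add: mult.commute)
  have "G_form a b 1 \<beta> 1 u = mat 1 ** diag2 (b * inverse \<beta>) (a * \<beta>) **
      (E (- ([:g:] * ([:c:] - v)) - [:\<beta>:]) ** E ([:c:] - shift v - [:inverse \<beta>:])) ** E 0"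
    unfolding G_form_word word_def
    by (simp add: tower_1[simplified] alt_def assms(5)[unfolded One_nat_def] c_def g_def)
  moreover have "upper x [:- (a * \<beta>):] y = mat2 [:x:] (- [:a * \<beta>:]) 0 ([:a:] + [:b:] - [:x:])"
    by (simp only: upper_def y rels(5))
  moreover have "shift_mat (E v) = mat2 (shift v) 1 (- 1) 0"
    by (simp add: mat2_simps)
  ultimately show ?thesis
    unfolding intertwines_def diag2_mat2 using G_form_base_identity[OF rels(1-4) rel] by metis
qed

section \<open>The Euclidean algorithm\<close>

text \<open>A class that contains all results of conjugating \<open>diag(a, b)\<close> by an upper triangular matrix and is
  closed under conjugation by \<open>E(v)\<close> with nonconstant \<open>v\<close>.\<close>

inductive core :: "complex \<Rightarrow> complex \<Rightarrow> pmat \<Rightarrow> bool" for a b where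
  const: "(x, y) \<in> {(a, b), (b, a)} \<Longrightarrow> core a b (upper x [:w:] y)"
| D: "d \<in> {0, 1} \<Longrightarrow> k \<ge> 1 \<Longrightarrow> nonconst_tuple k u \<Longrightarrow> core a b (D_form a b 1 d k u)"
| G: "\<beta> \<noteq> 0 \<Longrightarrow> k \<ge> 1 \<Longrightarrow> nonconst_tuple k u \<Longrightarrow> core a b (G_form a b 1 \<beta> k u)"

lemma core_upper:
  assumes "a \<noteq> 0" "b \<noteq> 0" "(x, y) \<in> {(a, b), (b, a)}"
  shows "core a b (upper x w y)"
proof (cases "degree w = 0")
  case True
  then obtain c where "w = [:c:]" by (rule degree_eq_zeroE)
  then show ?thesis using core.const assms(3) by blast
next
  case False
  define d :: nat where "d = (if (x, y) = (a, b) then 0 else 1)"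
  have alt: "alt a b d = x" "alt b a d = y" using assms(3) by (auto simp: d_def alt_def)
  have "x \<noteq> 0" using assms by auto
  then have "upper x w y = D_form a b 1 d 1 (\<lambda>_. smult (- 1 / x) w)"
    by (simp add: D_form_base[simplified] alt)
  moreover have "nonconst_tuple 1 (\<lambda>_. smult (- 1 / x) w)"
    using False \<open>x \<noteq> 0\<close> by (simp add: nonconst_tuple_def)
  ultimately show ?thesis using core.D[of d 1] by (simp add: d_def)
qed

lemma degree_diff_const: "degree (p - [:c:]) = degree p" for p :: "complex poly"
  by (cases p) simp

lemma degree_const_diff: "degree ([:c:] - p) = degree p" for p :: "complex poly"
  by (metis degree_diff_const degree_minus minus_diff_eq)

lemma D_form_cong:
  assumes "k \<ge> 1" "\<And>i. i \<in> {1..k} \<Longrightarrow> u i = v i"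
  shows "D_form a b 1 d k u = D_form a b 1 d k v"
  using assms tower_cong[of k u v] unfolding D_form_word by simp

lemma G_form_cong:
  assumes "k \<ge> 1" "\<And>i. i \<in> {1..k} \<Longrightarrow> u i = v i"
  shows "G_form a b 1 \<beta> k u = G_form a b 1 \<beta> k v"
  using assms tower_cong[of k u v] unfolding G_form_word by simp

text \<open>Since \<open>A\<close> is determined by \<open>B\<close> and \<open>v\<close>, it suffices to exhibit one member of the class that
  \<open>E(v)\<close> relates to \<open>B\<close>.\<close>

lemma core_step:
  assumes ab: "a \<noteq> 0" "b \<noteq> 0" and v: "degree v > 0"
    and "core a b B" "intertwines (E v) A B"
  shows "core a b A"
  using assms(4)
proof cases
  case (const x y w)
  show ?thesis
  proof (cases "w = 0")
    case True
    have "intertwines (E v) (upper y (smult y (shift v) - smult x v) x) B"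
      by (simp add: const True intertwines_def upper_def mat2_simps)
    then have "A = upper y (smult y (shift v) - smult x v) x"
      using assms(5) intertwines_unique invertible_E by blast
    then show ?thesis using core_upper[OF ab, of y x] const(2) by auto
  next
    case False
    define \<beta> where "\<beta> = - w / a"
    have w: "w = - (a * \<beta>)" and "\<beta> \<noteq> 0" using ab False by (simp_all add: \<beta>_def)
    define p where "p = [:(a - x) / (a * \<beta>):] - v"
    have "intertwines (E v) (G_form a b 1 \<beta> 1 (\<lambda>_. p)) B"
      unfolding const(1) w by (rule G_form_base[OF ab \<open>\<beta> \<noteq> 0\<close> const(2)]) (simp add: p_def)
    then have "A = G_form a b 1 \<beta> 1 (\<lambda>_. p)"
      using assms(5) intertwines_unique invertible_E by blast
    moreover have "degree p > 0"
      using v by (simp add: p_def degree_const_diff)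
    ultimately show ?thesis
      using core.G[OF \<open>\<beta> \<noteq> 0\<close>, of 1] by (simp add: nonconst_tuple_def)
  qed
next
  case (D d k u)
  define u' where "u' = u(Suc k := - v)"
  have "D_form a b 1 d k u = D_form a b 1 d k u'"
    using D(3) by (intro D_form_cong) (auto simp: u'_def)
  then have "intertwines (E v) (D_form a b 1 d (Suc k) u') B"
    using D_form_step[OF ab D(3), of u' d] D(1) by (simp add: u'_def)
  then have "A = D_form a b 1 d (Suc k) u'"
    using assms(5) intertwines_unique invertible_E by blast
  moreover have "nonconst_tuple (Suc k) u'"
    using D(4) v by (auto simp: nonconst_tuple_def u'_def)
  ultimately show ?thesis using core.D[OF D(2)] by simp
next
  case (G \<beta> k u)
  define u' where "u' = u(Suc k := - v)"
  have "G_form a b 1 \<beta> k u = G_form a b 1 \<beta> k u'"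
    using G(3) by (intro G_form_cong) (auto simp: u'_def)
  then have "intertwines (E v) (G_form a b 1 \<beta> (Suc k) u') B"
    using G_form_step[OF ab G(2,3), of u'] G(1) by (simp add: u'_def)
  then have "A = G_form a b 1 \<beta> (Suc k) u'"
    using assms(5) intertwines_unique invertible_E by blast
  moreover have "nonconst_tuple (Suc k) u'"
    using G(4) v by (auto simp: nonconst_tuple_def u'_def)
  ultimately show ?thesis using core.G[OF G(2)] by simp
qed

lemma invertible_left_factor:
  fixes X P :: pmat
  assumes "invertible X" "invertible (X ** P)"
  shows "invertible P"
proof -
  have "invertible (matrix_inv X)"
    using matrix_inv_mult[OF assms(1)] unfolding invertible_def by blast
  then have "invertible (matrix_inv X ** (X ** P))"
    using assms(2) by (rule invertible_mult)
  then show ?thesis by (simp add: matrix_cancel_left[OF assms(1)])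
qed

text \<open>Induction along the Euclidean algorithm: with \<open>v = - (p div r)\<close>, division by \<open>E(v)\<close> replaces the
  column \<open>(p, r)\<close> by \<open>(- r, p mod r)\<close>, which descends again. A descending column makes the
  quotient nonconstant, as \<open>core_step\<close> demands.\<close>

lemma core_if_column_descends:
  assumes ab: "a \<noteq> 0" "b \<noteq> 0"
    and "invertible P" "intertwines P A (diag2 a b)"
    and "P $ 2 $ 1 = 0 \<or> degree (P $ 2 $ 1) < degree (P $ 1 $ 1)"
  shows "core a b A"
  using assms(3-)
proof (induction "if P $ 2 $ 1 = 0 then 0 else Suc (degree (P $ 2 $ 1))" arbitrary: P A rule: less_induct)
  case less
  obtain p q r s where P: "P = mat2 p q r s" by (rule mat2_cases)
  show ?case
  proof (cases "r = 0")
    case True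
    \<comment> \<open>The algorithm has ended: \<open>P\<close> is upper triangular with constant diagonal.\<close>
    obtain P' where P': "P ** P' = mat 1" "P' ** P = mat 1"
      using less.prems(1) unfolding invertible_def by blast
    obtain p' q' r' s' where "P' = mat2 p' q' r' s'" by (rule mat2_cases)
    with P' have "p' * p = 1" "s * s' = 1"
      by (simp_all add: P True mat2_simps)
    then have "is_unit p" "is_unit s" by (auto simp: dvd_def mult.commute)
    then obtain p0 s0 where "p = [:p0:]" "s = [:s0:]" "p0 dvd 1" "s0 dvd 1"
      by (metis is_unit_polyE)
    then have ps: "p = [:p0:]" "s = [:s0:]" "p0 \<noteq> 0" "s0 \<noteq> 0" by auto
    obtain k1 k2 k3 k4 where A: "A = mat2 k1 k2 k3 k4" by (rule mat2_cases)
    have "smult p0 k3 = 0" and k1: "smult p0 k1 = smult p0 [:a:]"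
      using less.prems(2) by (simp_all add: intertwines_def P True ps A mat2_simps mult.commute)
    then have k3: "k3 = 0" using ps(3) by simp
    then have "smult s0 k4 = smult s0 [:b:]"
      using less.prems(2) by (simp add: intertwines_def P True ps A mat2_simps mult.commute)
    with k1 have "k1 = [:a:]" "k4 = [:b:]"
      using ps(3,4) by (metis smult_smult left_inverse smult_1_left)+
    then show ?thesis using core_upper[OF ab, of a b k2] by (simp add: A upper_def k3)
  next
    case False
    define v where "v = - (p div r)"
    have P_eq: "P = E v ** mat2 (- r) (- s) (p mod r) (q + v * s)"
      by (simp add: P mat2_simps v_def)
    have "degree v > 0"
    proof (rule ccontr)
      assume "\<not> degree v > 0"
      then have "degree (r * (p div r)) \<le> degree r"
        using degree_mult_le[of r "p div r"] by (simp add: v_def)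
      moreover have "degree (p mod r) \<le> degree r"
        using degree_mod_less[OF False, of p] by auto
      ultimately have "degree p \<le> degree r"
        using degree_add_le[of "r * (p div r)" "degree r" "p mod r"] by simp
      then show False using less.prems(3) False by (simp add: P)
    qed
    obtain B where B: "intertwines (E v) A B" "intertwines (mat2 (- r) (- s) (p mod r) (q + v * s)) B (diag2 a b)"
      using intertwines_factor invertible_E less.prems(2) unfolding P_eq by blast
    have "core a b B"
    proof (rule less.hyps[OF _ _ B(2)])
      show "invertible (mat2 (- r) (- s) (p mod r) (q + v * s))"
        using invertible_left_factor invertible_E less.prems(1) unfolding P_eq by blast
    qed (use False degree_mod_less[OF False, of p] in \<open>auto simp: P\<close>)
    then show ?thesis using core_step[OF ab \<open>degree v > 0\<close>] B(1) by blast
  qed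
qed

section \<open>The list of forms\<close>

text \<open>Naming the list turns each of its entries into an introduction rule.\<close>

definition listed :: "complex \<Rightarrow> complex \<Rightarrow> pmat \<Rightarrow> bool" where
  "listed a b K \<longleftrightarrow>
    (\<exists>e\<in>{0, 1}. K = diag2_br a b (int e))
  \<or> (\<exists>d\<in>{0, 1}. \<exists>e\<in>{0, 1}. \<exists>\<beta>. \<beta> \<noteq> 0 \<and>
       K = diag2_br (- a) (- b) (int d) ** mat_pow (E 0) (1 - e) ** E [:\<beta>:] ** mat_pow (E 0) e)
  \<or> (\<exists>\<beta>. \<beta> \<noteq> 0 \<and>
       K = - (diag2 (a * inverse \<beta>) (b * \<beta>) ** E [:- \<beta> - \<beta> * (b / a):]))
  \<or> (\<exists>\<beta> \<eta>. \<beta> \<noteq> 0 \<and> \<eta> \<noteq> 0 \<and>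
       K = diag2 (- a * \<beta> * inverse \<eta>) (- b * \<eta> * inverse \<beta>) ** E [:\<eta>:]
           ** E [:- ((\<beta> - \<eta>) * b / (a * \<beta>\<^sup>2)) + (\<beta> - \<eta>) / (\<beta> * \<eta>):])
  \<or> (\<exists>\<beta> \<eta> u\<^sub>1. \<beta> \<noteq> 0 \<and> \<eta> \<noteq> 0 \<and> degree u\<^sub>1 > 0 \<and>
       K = - (diag2 (b * inverse (\<beta> * \<eta>)) (a * \<beta> * \<eta>) ** E [:- \<eta>:]
              ** E (- smult (\<beta>\<^sup>2 * (a / b)) u\<^sub>1 - [:\<beta>:] - [:inverse \<eta>:])
              ** E (shift u\<^sub>1 - [:inverse \<beta>:])
              ** E [:- (\<eta> * \<beta>\<^sup>2 * (a / b)):]))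
  \<or> (\<exists>e\<in>{0, 1}. \<exists>d\<in>{0, 1}. \<exists>k\<ge>1. \<exists>u. nonconst_tuple k u \<and> K = D_form a b e d k u)
  \<or> (\<exists>e\<in>{0, 1}. \<exists>\<beta>. \<exists>k\<ge>1. \<exists>u. \<beta> \<noteq> 0 \<and> nonconst_tuple k u \<and> K = G_form a b e \<beta> k u)
  \<or> (\<exists>e\<in>{0, 1}. \<exists>\<eta>. \<exists>k\<ge>1. \<exists>u. \<eta> \<noteq> 0 \<and> nonconst_tuple k u \<and> K = K_form a b e \<eta> k u)
  \<or> (\<exists>\<beta> \<eta>. \<exists>k\<ge>1. \<exists>u. \<beta> \<noteq> 0 \<and> \<eta> \<noteq> 0 \<and> nonconst_tuple k u \<and> K = Z_form a b \<beta> \<eta> k u)"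

lemma listed_diagonal:
  "e \<in> {0, 1} \<Longrightarrow> listed a b (diag2_br a b (int e))"
  unfolding listed_def by (rule disjI1) blast

lemma listed_triangular:
  "d \<in> {0, 1} \<Longrightarrow> e \<in> {0, 1} \<Longrightarrow> \<beta> \<noteq> 0 \<Longrightarrow>
   listed a b (diag2_br (- a) (- b) (int d) ** mat_pow (E 0) (1 - e) ** E [:\<beta>:] ** mat_pow (E 0) e)"
  unfolding listed_def by (rule disjI1[THEN disjI2]) blast

lemma listed_zero_corner:
  "\<beta> \<noteq> 0 \<Longrightarrow> listed a b (- (diag2 (a * inverse \<beta>) (b * \<beta>) ** E [:- \<beta> - \<beta> * (b / a):]))"
  unfolding listed_def by (rule disjI1[THEN disjI2, THEN disjI2]) blast

lemma listed_full:
  "\<beta> \<noteq> 0 \<Longrightarrow> \<eta> \<noteq> 0 \<Longrightarrow> listed a b (diag2 (- a * \<beta> * inverse \<eta>) (- b * \<eta> * inverse \<beta>) ** E [:\<eta>:]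
           ** E [:- ((\<beta> - \<eta>) * b / (a * \<beta>\<^sup>2)) + (\<beta> - \<eta>) / (\<beta> * \<eta>):])"
  unfolding listed_def by (rule disjI1[THEN disjI2, THEN disjI2, THEN disjI2]) blast

lemma listed_D:
  "e \<in> {0, 1} \<Longrightarrow> d \<in> {0, 1} \<Longrightarrow> k \<ge> 1 \<Longrightarrow> nonconst_tuple k u \<Longrightarrow> listed a b (D_form a b e d k u)"
  unfolding listed_def
  by (rule disjI1[THEN disjI2, THEN disjI2, THEN disjI2, THEN disjI2,
        THEN disjI2]) blast

lemma listed_G:
  "e \<in> {0, 1} \<Longrightarrow> \<beta> \<noteq> 0 \<Longrightarrow> k \<ge> 1 \<Longrightarrow> nonconst_tuple k u \<Longrightarrow> listed a b (G_form a b e \<beta> k u)"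
  unfolding listed_def
  by (rule disjI1[THEN disjI2, THEN disjI2, THEN disjI2, THEN disjI2,
        THEN disjI2, THEN disjI2]) blast

lemma listed_K:
  "e \<in> {0, 1} \<Longrightarrow> \<eta> \<noteq> 0 \<Longrightarrow> k \<ge> 1 \<Longrightarrow> nonconst_tuple k u \<Longrightarrow> listed a b (K_form a b e \<eta> k u)"
  unfolding listed_def
  by (rule disjI1[THEN disjI2, THEN disjI2, THEN disjI2, THEN disjI2,
        THEN disjI2, THEN disjI2, THEN disjI2]) blast

lemma listed_Z:
  "\<beta> \<noteq> 0 \<Longrightarrow> \<eta> \<noteq> 0 \<Longrightarrow> k \<ge> 1 \<Longrightarrow> nonconst_tuple k u \<Longrightarrow> listed a b (Z_form a b \<beta> \<eta> k u)"
  unfolding listed_def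
  by (rule disjI2[THEN disjI2, THEN disjI2, THEN disjI2, THEN disjI2,
        THEN disjI2, THEN disjI2, THEN disjI2]) blast

lemma diagonal_form_mat2:
  "diag2_br a b (int e) = mat2 [:alt a b e:] 0 0 [:alt b a e:]"
  by (simp add: diag2_br_alt diag2_mat2)

lemma triangular_form_mat2:
  "diag2_br (- a) (- b) (int d) ** mat_pow (E 0) (1 - 0) ** E [:\<beta>:] ** mat_pow (E 0) 0
     = mat2 [:alt a b d:] 0 [:alt b a d * \<beta>:] [:alt b a d:]"
  "diag2_br (- a) (- b) (int d) ** mat_pow (E 0) (1 - 1) ** E [:\<beta>:] ** mat_pow (E 0) 1
     = mat2 [:alt a b d:] [:- (alt a b d * \<beta>):] 0 [:alt b a d:]"
  by (simp_all add: diag2_br_alt mat2_simps alt_def)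

lemma zero_corner_form_mat2:
  assumes "a \<noteq> 0" "\<beta> \<noteq> 0"
  shows "- (diag2 (a * inverse \<beta>) (b * \<beta>) ** E [:- \<beta> - \<beta> * (b / a):])
    = mat2 [:a + b:] [:- (a / \<beta>):] [:b * \<beta>:] 0"
  using assms by (simp add: mat2_simps field_simps)

lemma full_form_mat2:
  assumes "a \<noteq> 0" "\<beta> \<noteq> 0" "\<eta> \<noteq> 0"
  shows "diag2 (- a * \<beta> * inverse \<eta>) (- b * \<eta> * inverse \<beta>) ** E [:\<eta>:]
           ** E [:- ((\<beta> - \<eta>) * b / (a * \<beta>\<^sup>2)) + (\<beta> - \<eta>) / (\<beta> * \<eta>):]
    = mat2 [:a + b - b * \<eta> / \<beta>:] [:- (a * \<beta>):]
        [:(b * \<eta> / \<beta>) * (- ((\<beta> - \<eta>) * b / (a * \<beta>\<^sup>2)) + (\<beta> - \<eta>) / (\<beta> * \<eta>)):] [:b * \<eta> / \<beta>:]"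
  using assms by (simp add: mat2_simps one_pCons) (simp add: field_simps power2_eq_square)

text \<open>The constant entries of the list are separated by the vanishing of the upper right and lower right
  entries. Where the upper right entry is nonzero, it determines \<open>\<beta>\<close>, the lower right entry, if
  nonzero, determines \<open>\<eta>\<close>, and trace and determinant determine the rest.\<close>

lemma const_listed:
  assumes ab: "a \<noteq> 0" "b \<noteq> 0" and tr: "p + s = a + b" and det: "p * s - q * r = a * b"
  shows "listed a b (mat2 [:p:] [:q:] [:r:] [:s:])" (is "listed a b ?K")
proof (cases "q = 0")
  case True
  then have ps: "(p, s) \<in> {(a, b), (b, a)}"
    using trace_det_diagonal tr det by simp
  define d :: nat where "d = (if p = a then 0 else 1)"
  have d: "alt a b d = p" "alt b a d = s" "d \<in> {0, 1}" and s: "s \<noteq> 0"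
    using ps ab by (auto simp: d_def alt_def)
  show ?thesis
  proof (cases "r = 0")
    case r: True
    have "?K = diag2_br a b (int d)"
      by (simp only: diagonal_form_mat2 d True r pCons_0_0)
    then show ?thesis using listed_diagonal[OF d(3)] by simp
  next
    case r: False
    have "?K = diag2_br (- a) (- b) (int d) ** mat_pow (E 0) (1 - 0) ** E [:r / s:] ** mat_pow (E 0) 0"
      unfolding triangular_form_mat2 d using s by (simp add: True)
    moreover have "r / s \<noteq> 0" using r s by simp
    ultimately show ?thesis using listed_triangular[OF d(3), of 0] by simp
  qed
next
  case q: False
  show ?thesis
  proof (cases "s = 0")
    case True
    define \<beta> where "\<beta> = - a / q"
    have \<beta>: "\<beta> \<noteq> 0" "q = - (a / \<beta>)" using ab q by (simp_all add: \<beta>_def)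
    have "a * r = a * (b * \<beta>)" using det True \<beta> by (simp add: field_simps)
    then have "r = b * \<beta>" using ab by simp
    then have "?K = - (diag2 (a * inverse \<beta>) (b * \<beta>) ** E [:- \<beta> - \<beta> * (b / a):])"
      unfolding zero_corner_form_mat2[OF ab(1) \<beta>(1)] using tr True \<beta> by simp
    then show ?thesis using listed_zero_corner[OF \<beta>(1)] by simp
  next
    case False
    define \<beta> where "\<beta> = - q / a"
    define \<eta> where "\<eta> = s * \<beta> / b"
    have \<beta>: "\<beta> \<noteq> 0" "q = - (a * \<beta>)" and \<eta>: "\<eta> \<noteq> 0" "s = b * \<eta> / \<beta>"
      using ab q False by (simp_all add: \<beta>_def \<eta>_def)
    have p: "p = a + b - b * \<eta> / \<beta>" using tr \<eta> by (simp add: algebra_simps)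
    have "q * r = p * s - a * b" using det by algebra
    then have "r = (a * b - p * s) / (a * \<beta>)" using \<beta> ab by (simp add: field_simps)
    also have "\<dots> = (b * \<eta> / \<beta>) * (- ((\<beta> - \<eta>) * b / (a * \<beta>\<^sup>2)) + (\<beta> - \<eta>) / (\<beta> * \<eta>))"
      unfolding p \<eta>(2) using \<beta>(1) \<eta>(1) ab by (simp add: field_simps power2_eq_square)
    finally have "?K = diag2 (- a * \<beta> * inverse \<eta>) (- b * \<eta> * inverse \<beta>) ** E [:\<eta>:]
           ** E [:- ((\<beta> - \<eta>) * b / (a * \<beta>\<^sup>2)) + (\<beta> - \<eta>) / (\<beta> * \<eta>):]"
      unfolding full_form_mat2[OF ab(1) \<beta>(1) \<eta>(1)] by (simp only: p \<beta>(2) flip: \<eta>(2))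
    then show ?thesis using listed_full[OF \<beta>(1) \<eta>(1)] by simp
  qed
qed

lemma core_listed:
  assumes ab: "a \<noteq> 0" "b \<noteq> 0" and "core a b K"
  shows "listed a b K"
  using assms(3)
proof cases
  case (const x y w)
  then show ?thesis using const_listed[OF ab, of x y w 0] by (auto simp: upper_def add.commute mult.commute)
qed (auto intro: listed_D[of 1, simplified] listed_G[of 1, simplified])

lemma core_zero_listed:
  assumes ab: "a \<noteq> 0" "b \<noteq> 0" and "core a b B" "intertwines (E 0) A B"
  shows "listed a b A"
  using assms(3)
proof cases
  case (const x y w)
  have "intertwines (E 0) (mat2 [:y:] [:0:] [:- w:] [:x:]) B"
    by (simp add: const(1) intertwines_def upper_def mat2_simps)
  then have "A = mat2 [:y:] [:0:] [:- w:] [:x:]"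
    using assms(4) intertwines_unique invertible_E by blast
  then show ?thesis using const_listed[OF ab, of y x 0 "- w"] const(2) by (auto simp: add.commute mult.commute)
next
  case (D d k u)
  then have "A = D_form a b 0 d k u"
    using assms(4) D_form_zero intertwines_unique invertible_E by blast
  then show ?thesis using listed_D[of 0 d k u] D by simp
next
  case (G \<beta> k u)
  then have "A = G_form a b 0 \<beta> k u"
    using assms(4) G_form_zero intertwines_unique invertible_E by blast
  then show ?thesis using listed_G[of 0 \<beta> k u] G by simp
qed

lemma core_lower_listed:
  assumes ab: "a \<noteq> 0" "b \<noteq> 0" and "core a b B" "intertwines (lower t) A B" "t \<noteq> 0"
  shows "listed a b A"
  using assms(3)
proof cases
  case (const x y w)
  let ?A = "mat2 [:x - w * t:] [:w:] [:t * x - t * (t * w + y):] [:t * w + y:]"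
  have "intertwines (lower t) ?A B"
    by (simp add: const(1) intertwines_def lower_def upper_def mat2_simps algebra_simps)
  then have "A = ?A"
    using assms(4) intertwines_unique invertible_lower by blast
  moreover have "x + y = a + b" "x * y = a * b" using const(2) by auto
  ultimately show ?thesis by (auto intro!: const_listed[OF ab] simp: algebra_simps)
next
  case (D d k u)
  define \<eta> where "\<eta> = t * (a / b) powi ((- 1) ^ (k + 1 + d))"
  have "\<eta> \<noteq> 0" using ab assms(5) by (simp add: \<eta>_def)
  define u' where "u' = (if k = 1 then (\<lambda>_. u 1 - [:inverse \<eta>:]) else u)"
  have "nonconst_tuple k u'"
    using D(4) by (simp add: nonconst_tuple_def u'_def degree_diff_const)
  have "D_form a b 1 d k (if k = 1 then (\<lambda>_. u' 1 + [:inverse \<eta>:]) else u') = D_form a b 1 d k u"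
    using D(3) by (intro D_form_cong) (auto simp: u'_def)
  then have "intertwines (lower t) (K_form a b d \<eta> k u') B"
    using K_form_lower[OF ab D(3) assms(5) \<eta>_def D(2), of u'] D(1) by simp
  then have "A = K_form a b d \<eta> k u'"
    using assms(4) intertwines_unique invertible_lower by blast
  then show ?thesis using listed_K[OF D(2) \<open>\<eta> \<noteq> 0\<close> D(3) \<open>nonconst_tuple k u'\<close>] by simp
next
  case (G \<beta> k u)
  define \<eta> where "\<eta> = t * (\<beta>\<^sup>2 * (a / b)) powi ((- 1) ^ k)"
  have "\<eta> \<noteq> 0" using ab assms(5) G(2) by (simp add: \<eta>_def)
  have "A = Z_form a b \<beta> \<eta> k u"
    using Z_form_lower[OF ab G(2,3) assms(5) \<eta>_def] assms(4) intertwines_unique invertible_lower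
    unfolding G(1) by blast
  then show ?thesis using listed_Z[OF G(2) \<open>\<eta> \<noteq> 0\<close> G(3,4)] by simp
qed

text \<open>The degrees in the first column \<open>(p, r)\<close> of the transforming matrix decide which outermost factor has
  to be split off so that the remaining column descends: none if \<open>deg p > deg r\<close>, \<open>E(0)\<close> if
  \<open>deg p < deg r\<close>, and \<open>lower t\<close> with the quotient \<open>t\<close> of the leading coefficients if the degrees
  agree, where a zero entry counts as having the smaller degree.\<close>

lemma similar_imp_listed:
  assumes ab: "a \<noteq> 0" "b \<noteq> 0" and "sigma_inv_similar A (diag2 a b)"
  shows "listed a b A"
proof -
  obtain P where P: "invertible P" "intertwines P A (diag2 a b)"
    using assms(3) unfolding sigma_inv_similar_iff by blast
  have peel: "\<exists>B. intertwines X A B \<and> core a b B"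
    if X: "invertible X" "P = X ** Q" and "Q $ 2 $ 1 = 0 \<or> degree (Q $ 2 $ 1) < degree (Q $ 1 $ 1)" for X Q
  proof -
    obtain B where B: "intertwines X A B" "intertwines Q B (diag2 a b)"
      using intertwines_factor X P(2) by blast
    have "invertible Q" using invertible_left_factor X P(1) by blast
    then show ?thesis using B core_if_column_descends[OF ab] that(3) by blast
  qed
  obtain p q r s where P_eq: "P = mat2 p q r s" by (rule mat2_cases)
  consider "r = 0 \<or> degree r < degree p" | "r \<noteq> 0" "p = 0 \<or> degree p < degree r"
    | "r \<noteq> 0" "p \<noteq> 0" "degree p = degree r"
    by force
  then show ?thesis
  proof cases
    case 1
    then show ?thesis using core_listed[OF ab] core_if_column_descends[OF ab P] by (simp add: P_eq)
  next
    case 2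
    have "P = E 0 ** mat2 (- r) (- s) p q" by (simp add: P_eq mat2_simps)
    from peel[OF invertible_E this] 2 show ?thesis
      using core_zero_listed[OF ab] by auto
  next
    case 3
    define t where "t = lead_coeff r / lead_coeff p"
    have lead: "lead_coeff p \<noteq> 0" "lead_coeff r \<noteq> 0" using 3(1,2) by simp_all
    then have "t \<noteq> 0" by (simp add: t_def)
    have "P = lower t ** mat2 p q (r - smult t p) (s - smult t q)"
      by (simp add: P_eq mat2_simps lower_def)
    moreover have "r - smult t p = 0 \<or> degree (r - smult t p) < degree p"
    proof -
      have "lead_coeff r - t * lead_coeff p = 0" using lead(1) by (simp add: t_def)
      then have "coeff (r - smult t p) (degree p) = 0" using 3(3) by simp
      moreover have "degree (r - smult t p) \<le> degree p"
        using 3 degree_diff_le[of r "degree p" "smult t p"] degree_smult_le[of t p] by simp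
      ultimately show ?thesis by (metis le_neq_implies_less leading_coeff_0_iff)
    qed
    ultimately show ?thesis
      using peel[OF invertible_lower, of t] core_lower_listed[OF ab _ _ \<open>t \<noteq> 0\<close>] by fastforce
  qed
qed

lemma D_form_similar:
  assumes "a \<noteq> 0" "b \<noteq> 0" "k \<ge> 1"
  shows "sigma_inv_similar (D_form a b 1 d k u) (diag2 a b)"
  using assms(3)
proof (induction k rule: nat_induct_at_least)
  case base
  show ?case unfolding D_form_base by (rule upper_similar[OF assms(1,2)]) (simp add: alt_def)
next
  case (Suc k)
  then show ?case using similar_if_intertwines[OF invertible_E D_form_step[OF assms(1,2)]] by blast
qed

lemma G_form_similar:
  assumes "a \<noteq> 0" "b \<noteq> 0" "\<beta> \<noteq> 0" "k \<ge> 1"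
  shows "sigma_inv_similar (G_form a b 1 \<beta> k u) (diag2 a b)"
  using assms(4)
proof (induction k rule: nat_induct_at_least)
  case base
  show ?case
    by (rule similar_if_intertwines[OF invertible_E
          G_form_base[OF assms(1-3), of a b u "- u 1"] upper_similar[OF assms(1,2)]]) simp_all
next
  case (Suc k)
  then show ?case using similar_if_intertwines[OF invertible_E G_form_step[OF assms(1-3)]] by blast
qed

lemma K_form_similar:
  assumes "a \<noteq> 0" "b \<noteq> 0" "k \<ge> 1" "\<eta> \<noteq> 0" "e \<in> {0, 1}"
  shows "sigma_inv_similar (K_form a b e \<eta> k u) (diag2 a b)"
proof -
  define t where "t = \<eta> / (a / b) powi ((- 1) ^ (k + 1 + e))"
  have "t \<noteq> 0" "\<eta> = t * (a / b) powi ((- 1) ^ (k + 1 + e))"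
    using assms by (simp_all add: t_def)
  then show ?thesis
    using similar_if_intertwines[OF invertible_lower K_form_lower D_form_similar] assms by blast
qed

lemma Z_form_similar:
  assumes "a \<noteq> 0" "b \<noteq> 0" "\<beta> \<noteq> 0" "k \<ge> 1" "\<eta> \<noteq> 0"
  shows "sigma_inv_similar (Z_form a b \<beta> \<eta> k u) (diag2 a b)"
proof -
  define t where "t = \<eta> / (\<beta>\<^sup>2 * (a / b)) powi ((- 1) ^ k)"
  have "t \<noteq> 0" "\<eta> = t * (\<beta>\<^sup>2 * (a / b)) powi ((- 1) ^ k)"
    using assms by (simp_all add: t_def)
  then show ?thesis
    using similar_if_intertwines[OF invertible_lower Z_form_lower G_form_similar] assms by blast
qed

text \<open>The entry of the list with a single polynomial \<open>u\<^sub>1\<close> is the word \<open>Z\<close> of length \<open>k = 1\<close>.\<close>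

lemma Z_form_1:
  "- (diag2 (b * inverse (\<beta> * \<eta>)) (a * \<beta> * \<eta>) ** E [:- \<eta>:]
              ** E (- smult (\<beta>\<^sup>2 * (a / b)) v - [:\<beta>:] - [:inverse \<eta>:])
              ** E (shift v - [:inverse \<beta>:])
              ** E [:- (\<eta> * \<beta>\<^sup>2 * (a / b)):]) = Z_form a b \<beta> \<eta> 1 (\<lambda>_. v)"
  by (simp add: Z_form_def mult_ac)

lemma listed_imp_similar:
  assumes ab: "a \<noteq> 0" "b \<noteq> 0" and "listed a b K"
  shows "sigma_inv_similar K (diag2 a b)"
proof -
  have const: "sigma_inv_similar K (diag2 a b)"
    if "K = mat2 [:p:] [:q:] [:r:] [:s:]" "p + s = a + b" "p * s - q * r = a * b" for p q r s
    using const_similar[OF ab that(2,3)] that(1) by simp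
  from assms(3) show ?thesis
    unfolding listed_def
  proof (elim disjE bexE exE conjE)
    fix e assume "K = diag2_br a b (int e)"
    then show ?thesis
      by (intro const[of "alt a b e" 0 0 "alt b a e"]) (simp_all add: diagonal_form_mat2 alt_def)
  next
    fix d e \<beta> assume "e \<in> {0, 1 :: nat}" and
      K: "K = diag2_br (- a) (- b) (int d) ** mat_pow (E 0) (1 - e) ** E [:\<beta>:] ** mat_pow (E 0) e"
    then consider "e = 0" | "e = 1" by auto
    then show ?thesis
    proof cases
      case 1
      show ?thesis
        by (rule const[of "alt a b d" 0 "alt b a d * \<beta>" "alt b a d"])
          (simp_all only: K 1 triangular_form_mat2, simp_all add: alt_def)
    next
      case 2
      show ?thesis
        by (rule const[of "alt a b d" "- (alt a b d * \<beta>)" 0 "alt b a d"])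
          (simp_all only: K 2 triangular_form_mat2, simp_all add: alt_def)
    qed
  next
    fix \<beta> assume nz: "\<beta> \<noteq> 0" and
      "K = - (diag2 (a * inverse \<beta>) (b * \<beta>) ** E [:- \<beta> - \<beta> * (b / a):])"
    then have "K = mat2 [:a + b:] [:- (a / \<beta>):] [:b * \<beta>:] [:0:]"
      by (simp only: zero_corner_form_mat2[OF ab(1) nz] pCons_0_0)
    then show ?thesis by (rule const) (use nz in simp_all)
  next
    fix \<beta> \<eta> assume nz: "\<beta> \<noteq> 0" "\<eta> \<noteq> 0" and
      K: "K = diag2 (- a * \<beta> * inverse \<eta>) (- b * \<eta> * inverse \<beta>) ** E [:\<eta>:]
           ** E [:- ((\<beta> - \<eta>) * b / (a * \<beta>\<^sup>2)) + (\<beta> - \<eta>) / (\<beta> * \<eta>):]"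
    show ?thesis
      by (rule const[OF K[unfolded full_form_mat2[OF ab(1) nz]]])
        (use nz ab in \<open>simp_all add: field_simps power2_eq_square\<close>)
  next
    fix \<beta> \<eta> v assume nz: "\<beta> \<noteq> 0" "\<eta> \<noteq> 0" and
      "K = - (diag2 (b * inverse (\<beta> * \<eta>)) (a * \<beta> * \<eta>) ** E [:- \<eta>:]
              ** E (- smult (\<beta>\<^sup>2 * (a / b)) v - [:\<beta>:] - [:inverse \<eta>:])
              ** E (shift v - [:inverse \<beta>:])
              ** E [:- (\<eta> * \<beta>\<^sup>2 * (a / b)):])"
    then show ?thesis
      unfolding Z_form_1 using Z_form_similar[OF ab nz(1) _ nz(2)] by simp
  qed (auto intro: D_form_similar[OF ab, simplified] G_form_similar[OF ab, simplified]
        K_form_similar[OF ab] Z_form_similar[OF ab]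
        similar_if_intertwines[OF invertible_E D_form_zero D_form_similar[OF ab]]
        similar_if_intertwines[OF invertible_E G_form_zero G_form_similar[OF ab]])
qed

theorem theorem3p15:
  fixes a b :: complex and K :: pmat
  assumes "a \<noteq> 0" and "b \<noteq> 0" and "invertible K"
  shows "sigma_inv_similar K (diag2 a b) \<longleftrightarrow>
    (\<exists>e\<in>{0, 1}. K = diag2_br a b (int e))
  \<or> (\<exists>d\<in>{0, 1}. \<exists>e\<in>{0, 1}. \<exists>\<beta>. \<beta> \<noteq> 0 \<and>
       K = diag2_br (- a) (- b) (int d) ** mat_pow (E 0) (1 - e) ** E [:\<beta>:] ** mat_pow (E 0) e)
  \<or> (\<exists>\<beta>. \<beta> \<noteq> 0 \<and>
       K = - (diag2 (a * inverse \<beta>) (b * \<beta>) ** E [:- \<beta> - \<beta> * (b / a):]))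
  \<or> (\<exists>\<beta> \<eta>. \<beta> \<noteq> 0 \<and> \<eta> \<noteq> 0 \<and>
       K = diag2 (- a * \<beta> * inverse \<eta>) (- b * \<eta> * inverse \<beta>) ** E [:\<eta>:]
           ** E [:- ((\<beta> - \<eta>) * b / (a * \<beta>\<^sup>2)) + (\<beta> - \<eta>) / (\<beta> * \<eta>):])
  \<or> (\<exists>\<beta> \<eta> u\<^sub>1. \<beta> \<noteq> 0 \<and> \<eta> \<noteq> 0 \<and> degree u\<^sub>1 > 0 \<and>
       K = - (diag2 (b * inverse (\<beta> * \<eta>)) (a * \<beta> * \<eta>) ** E [:- \<eta>:]
              ** E (- smult (\<beta>\<^sup>2 * (a / b)) u\<^sub>1 - [:\<beta>:] - [:inverse \<eta>:])
              ** E (shift u\<^sub>1 - [:inverse \<beta>:])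
              ** E [:- (\<eta> * \<beta>\<^sup>2 * (a / b)):]))
  \<or> (\<exists>e\<in>{0, 1}. \<exists>d\<in>{0, 1}. \<exists>k\<ge>1. \<exists>u. nonconst_tuple k u \<and> K = D_form a b e d k u)
  \<or> (\<exists>e\<in>{0, 1}. \<exists>\<beta>. \<exists>k\<ge>1. \<exists>u. \<beta> \<noteq> 0 \<and> nonconst_tuple k u \<and> K = G_form a b e \<beta> k u)
  \<or> (\<exists>e\<in>{0, 1}. \<exists>\<eta>. \<exists>k\<ge>1. \<exists>u. \<eta> \<noteq> 0 \<and> nonconst_tuple k u \<and> K = K_form a b e \<eta> k u)
  \<or> (\<exists>\<beta> \<eta>. \<exists>k\<ge>1. \<exists>u. \<beta> \<noteq> 0 \<and> \<eta> \<noteq> 0 \<and> nonconst_tuple k u \<and> K = Z_form a b \<beta> \<eta> k u)"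
  using similar_imp_listed[OF assms(1,2), of K] listed_imp_similar[OF assms(1,2), of K]
  unfolding listed_def by (rule iffI)

end
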